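(* Let $m\ge2$, let $C_1,\dots,C_m$ be closed subsets of a Euclidean space $X$, $I=\{1,\dots,m\}$, $w\in C:=\bigcap_{i\in I}C_i$, $\varepsilon\in[0,1)$ and $\delta>0$. Suppose that: (a) $\{C_i\}_{i\in I}$ is $\kappa$-linearly regular on $\mathbb{B}(w;\delta/2)$ for some $\kappa>0$. (b) $\{C_i\}_{i\in I}$ is $(\varepsilon,\delta)$-regular at $w$. (c) It holds that $$\rho:=\left[\frac{1}{(1-\varepsilon)^{m-1}}-\frac{1}{(m-1)\kappa^2}\right]_+^{\frac{1}{2(m-1)}}<1.$$ Then, whenever the starting point is sufficiently close to $w$ (i.e., there is $r>0$ such that this holds for all $x_0\in\mathbb{B}(w;r)$), every cyclic sequence generated by the classical projections $(P_{C_i})_{i\in I}$ converges $R$-linearly to a point $\bar x\in C$ with rate $\rho$.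
   Context: $X$ is a Euclidean space with inner product $\langle\cdot,\cdot\rangle$ and norm $\|\cdot\|$. $\mathbb{B}(w;\rho)$ is the closed ball with center $w$ and radius $\rho$. $[t]_+:=\max\{0,t\}$. For a nonempty closed set $C$: $d_C(x)=\inf_{c\in C}\|x-c\|$ and $P_Cx=\{c\in C:\|x-c\|=d_C(x)\}$ (set-valued projector). Cyclic sequences: for set-valued operators $T_1,\dots,T_m$ on $X$, put $T_{mn+i}:=T_i$ for $n\in\mathbb{N}$, $i\in I$; a cyclic sequence generated by $(T_i)_{i\in I}$ is any sequence with $x_0\in X$ and $x_{n+1}\in T_{n+1}x_n$ for all $n\in\mathbb{N}=\{0,1,2,\dots\}$. $R$-linear convergence: $(x_n)$ converges $R$-linearly to $\bar x$ with rate $\rho\in[0,1)$ if there is $\sigma\ge0$ with $\|x_n-\bar x\|\le\sigma\rho^n$ for all $n\in\mathbb{N}$. Linear regularity: $\{C_i\}_{i\in I}$ is $\kappa$-linearly regular on $U\subseteq X$ if $d_C(x)\le\kappa\max_{i\in I}d_{C_i}(x)$ for all $x\in U$, where $C=\bigcap_{i\in I}C_i$. Regularity of sets: the proximal normal cone to $C$ at $x\in C$ is $N^{\rm prox}_C(x)=\{\lambda(z-x): x\in P_Cz,\ \lambda\ge0\}$. $C$ is $(\varepsilon,\delta)$-regular at $w$ if for all $x,y\in C\cap\mathbb{B}(w;\delta)$ and $u\in N^{\rm prox}_C(x)$ one has $\langle u,x-y\rangle\ge-\varepsilon\|u\|\,\|x-y\|$. The system $\{C_i\}_{i\in I}$ is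 $(\varepsilon,\delta)$-regular at $w$ if every $C_i$ is.
   Formalization: If m=2, ε=0, κ=1 (so ρ=0), the bound is asserted for (x_{n+1}) instead of (x_n), i.e. x_n equals the limit from n=2 on; the original claim fails there, e.g. C_1=ℝ, C_2={0}, w=0, where x_1=x_0≠0. All other cases are as stated. *)

theory Defs
  imports "HOL-Analysis.Analysis"
begin

definition proj_set :: "'a::euclidean_space set \<Rightarrow> 'a \<Rightarrow> 'a set" where
  "proj_set C x = {c \<in> C. norm (x - c) = infdist x C}"

definition prox_normal_cone :: "'a::euclidean_space set \<Rightarrow> 'a \<Rightarrow> 'a set" where
  "prox_normal_cone C x = {l *\<^sub>R (z - x) |l z. x \<in> proj_set C z \<and> 0 \<le> l}"

definition regular_set_at :: "real \<Rightarrow> real \<Rightarrow> 'a::euclidean_space set \<Rightarrow> 'a \<Rightarrow> bool" where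
  "regular_set_at \<epsilon> \<delta> C w \<longleftrightarrow>
     (\<forall>x \<in> C \<inter> cball w \<delta>. \<forall>y \<in> C \<inter> cball w \<delta>. \<forall>u \<in> prox_normal_cone C x.
        u \<bullet> (x - y) \<ge> - \<epsilon> * norm u * norm (x - y))"

definition regular_system_at ::
    "real \<Rightarrow> real \<Rightarrow> 'i set \<Rightarrow> ('i \<Rightarrow> 'a::euclidean_space set) \<Rightarrow> 'a \<Rightarrow> bool" where
  "regular_system_at \<epsilon> \<delta> I C w \<longleftrightarrow> (\<forall>i\<in>I. regular_set_at \<epsilon> \<delta> (C i) w)"

definition linearly_regular_on ::
    "real \<Rightarrow> 'i set \<Rightarrow> ('i \<Rightarrow> 'a::euclidean_space set) \<Rightarrow> 'a set \<Rightarrow> bool" where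
  "linearly_regular_on \<kappa> I C U \<longleftrightarrow>
     (\<forall>x\<in>U. infdist x (\<Inter>i\<in>I. C i) \<le> \<kappa> * (MAX i\<in>I. infdist x (C i)))"

text \<open>
  The operators \<open>T 1, \<dots>, T m\<close> are extended \<open>m\<close>-periodically to all positive indices, so the
  operator with index \<open>n + 1\<close> is \<open>T (n mod m + 1)\<close>.
\<close>

definition cyclic_sequence ::
    "nat \<Rightarrow> (nat \<Rightarrow> 'a::euclidean_space \<Rightarrow> 'a set) \<Rightarrow> (nat \<Rightarrow> 'a) \<Rightarrow> bool" where
  "cyclic_sequence m T x \<longleftrightarrow> (\<forall>n. x (Suc n) \<in> T (n mod m + 1) (x n))"

text \<open>
  The bound is required at every index. Since \<open>0 ^ 0 = 1\<close>, rate \<open>0\<close> means that the sequence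
  equals its limit from index \<open>1\<close> on.

  This matters for cyclic projections in the corner case \<open>m = 2\<close>, \<open>\<epsilon> = 0\<close>, \<open>\<kappa> = 1\<close>, where the
  rate is \<open>0\<close> but the limit may be reached only at index \<open>2\<close>: for \<open>C 1 = UNIV\<close> and
  \<open>C 2 = {w}\<close> one gets \<open>x 1 = x 0\<close> and \<open>x 2 = w\<close>. In this one case the theorem asserts the
  bound for the sequence started at index \<open>1\<close>. In all other cases of rate \<open>0\<close> one has \<open>\<kappa> < 1\<close>,
  hence a neighbourhood of \<open>w\<close> lies in every \<open>C i\<close>, and no exception is needed.
\<close>

definition converges_R_linearly :: "(nat \<Rightarrow> 'a::euclidean_space) \<Rightarrow> 'a \<Rightarrow> real \<Rightarrow> bool" where
  "converges_R_linearly x xbar \<rho> \<longleftrightarrow>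
     0 \<le> \<rho> \<and> \<rho> < 1 \<and> (\<exists>\<sigma>\<ge>0. \<forall>n. norm (x n - xbar) \<le> \<sigma> * \<rho> ^ n)"

end

theory Submission
  imports Defs
begin

text \<open>
  A projection step \<open>p \<in> P\<^sub>A x\<close> onto a regular set satisfies
  \<open>\<parallel>p - c\<parallel>\<^sup>2 \<le> \<parallel>x - c\<parallel>\<^sup>2 / (1 - \<epsilon>) - \<parallel>x - p\<parallel>\<^sup>2\<close>. After the first step the iterate already lies in one
  of the sets, so \<open>m - 1\<close> further steps visit all of them. Telescoping over these steps with \<open>c\<close> a nearest
  point of the intersection, and estimating the sum of the squared steps from below by linear regularity
  and Cauchy-Schwarz, yields \<open>d\<^sub>C (x (n + m - 1))\<^sup>2 \<le> \<rho> ^ (2 * (m - 1)) * d\<^sub>C (x n)\<^sup>2\<close> for \<open>n \<ge> 1\<close>. Since each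
  step is no longer than \<open>d\<^sub>C (x n)\<close>, the steps decay geometrically, which gives convergence and also
  keeps the sequence near \<open>w\<close>. If \<open>\<rho> = 0\<close>, then \<open>\<kappa> < 1\<close> except in the corner case, and linear
  regularity puts a ball around \<open>w\<close> inside the intersection.
\<close>

section \<open>Projections onto a single set\<close>

lemma proj_setD:
  assumes "p \<in> proj_set A x"
  shows "p \<in> A" "norm (x - p) = infdist x A"
  using assms by (auto simp: proj_set_def)

lemma proj_set_norm_le:
  assumes "p \<in> proj_set A x" "c \<in> A"
  shows "norm (x - p) \<le> norm (x - c)"
  using assms infdist_le[of c A x] by (auto simp: proj_set_def dist_norm)

lemma proj_set_norm_diff_le:
  assumes "p \<in> proj_set A x" "c \<in> A"
  shows "norm (p - c) \<le> 2 * norm (x - c)"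
proof -
  have "norm (p - c) \<le> norm (x - p) + norm (x - c)"
    using norm_triangle_ineq4[of "x - c" "x - p"] by simp
  then show ?thesis
    using proj_set_norm_le[OF assms] by simp
qed

text \<open>Expanding \<open>norm (x - c)\<close> squared around \<open>p\<close> leaves a cross
  term. As \<open>x - p\<close> is a proximal normal at \<open>p\<close>, regularity bounds this
  term below, and \<open>2 * a * b \<le> a^2 + b^2\<close> absorbs the loss equally into both
  squares. Dividing by \<open>1 - \<epsilon>\<close> therefore leaves the squared step with
  coefficient 1.\<close>

lemma regular_proj_step:
  fixes A :: "'a::euclidean_space set"
  assumes reg: "regular_set_at \<epsilon> \<delta> A w" and \<epsilon>: "0 \<le> \<epsilon>" "\<epsilon> < 1"
    and p: "p \<in> proj_set A x" "p \<in> cball w \<delta>" and c: "c \<in> A" "c \<in> cball w \<delta>"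
  shows "(norm (p - c))\<^sup>2 \<le> 1 / (1 - \<epsilon>) * (norm (x - c))\<^sup>2 - (norm (x - p))\<^sup>2"
proof -
  let ?a = "norm (x - p)" and ?b = "norm (p - c)"
  have "x - p \<in> prox_normal_cone A p"
    unfolding prox_normal_cone_def using p(1) by (force intro: exI[of _ 1])
  then have "(x - p) \<bullet> (p - c) \<ge> - \<epsilon> * ?a * ?b"
    using reg p c proj_setD(1)[OF p(1)] unfolding regular_set_at_def by blast
  moreover have "(norm (x - c))\<^sup>2 = ?a\<^sup>2 + ?b\<^sup>2 + 2 * ((x - p) \<bullet> (p - c))"
    by (simp add: power2_norm_eq_inner algebra_simps inner_commute)
  moreover have "\<epsilon> * (2 * ?a * ?b) \<le> \<epsilon> * (?a\<^sup>2 + ?b\<^sup>2)"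
    using \<epsilon>(1) by (intro mult_left_mono sum_squares_bound)
  ultimately have "(1 - \<epsilon>) * (?b\<^sup>2 + ?a\<^sup>2) \<le> (norm (x - c))\<^sup>2"
    by (simp add: algebra_simps)
  then show ?thesis
    using \<epsilon>(2) by (simp add: field_simps)
qed

section \<open>Telescoping and geometrically decaying steps\<close>

lemma telescoped_decrease:
  fixes s a :: "nat \<Rightarrow> real"
  assumes "1 \<le> \<beta>" and "\<And>k. 0 \<le> a k" and "\<And>k. k < N \<Longrightarrow> s (Suc k) \<le> \<beta> * s k - a k"
  shows "s N \<le> \<beta> ^ N * s 0 - (\<Sum>k<N. a k)"
  using assms(3)
proof (induction N)
  case 0
  then show ?case by simp
next
  case (Suc N)
  have "s (Suc N) \<le> \<beta> * s N - a N"
    using Suc.prems by simp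
  also have "\<beta> * s N \<le> \<beta> * (\<beta> ^ N * s 0 - (\<Sum>k<N. a k))"
    using Suc assms(1) by (intro mult_left_mono) auto
  \<comment> \<open>As \<open>1 \<le> \<beta>\<close>, dropping the factor on the nonnegative sum
    only weakens the bound.\<close>
  also have "\<dots> \<le> \<beta> ^ Suc N * s 0 - (\<Sum>k<N. a k)"
    using mult_right_mono[OF assms(1), of "\<Sum>k<N. a k"] assms(2)
    by (simp add: sum_nonneg algebra_simps)
  finally show ?case by simp
qed

lemma norm_diff_le_sum_steps:
  fixes x :: "nat \<Rightarrow> 'a::real_normed_vector"
  shows "norm (x n - x (n + k)) \<le> (\<Sum>i<k. norm (x (n + i) - x (Suc (n + i))))"
proof (induction k)
  case (Suc k)
  then show ?case
    using norm_triangle_ineq[of "x n - x (n + k)" "x (n + k) - x (Suc (n + k))"] by simp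
qed simp

text \<open>Only steps inside the window are assumed small, so this applies within an induction that
  knows the decay up to the current index. The bound is uniform in \<open>k\<close>, so it also
  passes to the limit.\<close>

lemma norm_diff_le_geometric:
  fixes x :: "nat \<Rightarrow> 'a::real_normed_vector"
  assumes "0 \<le> K" "0 \<le> \<rho>" "\<rho> < 1"
    and "\<And>i. i < k \<Longrightarrow> norm (x (n + i) - x (Suc (n + i))) \<le> K * \<rho> ^ (n + i)"
  shows "norm (x n - x (n + k)) \<le> K / (1 - \<rho>) * \<rho> ^ n"
proof -
  have "norm (x n - x (n + k)) \<le> (\<Sum>i<k. K * \<rho> ^ (n + i))"
    by (rule order_trans[OF norm_diff_le_sum_steps]) (auto intro: sum_mono assms(4))
  also have "\<dots> = K * \<rho> ^ n * (\<Sum>i<k. \<rho> ^ i)"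
    by (simp add: sum_distrib_left power_add mult.assoc)
  also have "(\<Sum>i<k. \<rho> ^ i) \<le> 1 / (1 - \<rho>)"
    using assms(2,3) by (simp add: sum_gp_strict divide_right_mono)
  finally show ?thesis
    using assms by (simp add: mult_left_mono)
qed

lemma geometric_steps_limit:
  fixes x :: "nat \<Rightarrow> 'a::banach"
  assumes K: "0 \<le> K" and \<rho>: "0 \<le> \<rho>" "\<rho> < 1"
    and step: "\<And>n. norm (x n - x (Suc n)) \<le> K * \<rho> ^ n"
  obtains l where "x \<longlonglongrightarrow> l" "\<And>n. norm (x n - l) \<le> K / (1 - \<rho>) * \<rho> ^ n"
proof -
  have "summable (\<lambda>n. x (Suc n) - x n)"
  proof (rule summable_comparison_test)
    show "\<exists>N. \<forall>n\<ge>N. norm (x (Suc n) - x n) \<le> K * \<rho> ^ n"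
      using step by (simp add: norm_minus_commute)
    show "summable (\<lambda>n. K * \<rho> ^ n)"
      using \<rho> by (intro summable_mult summable_geometric) simp
  qed
  then have "convergent (\<lambda>n. \<Sum>i<n. x (Suc i) - x i)"
    by (simp add: summable_iff_convergent)
  then have "convergent (\<lambda>n. x n - x 0)"
    by (simp add: sum_lessThan_telescope)
  from convergent_add[OF this convergent_const[of "x 0"]] have "convergent x"
    by simp
  then obtain l where l: "x \<longlonglongrightarrow> l"
    by (auto simp: convergent_def)
  have "norm (x n - l) \<le> K / (1 - \<rho>) * \<rho> ^ n" for n
  proof (rule tendsto_upperbound)
    show "(\<lambda>k. norm (x n - x (n + k))) \<longlonglongrightarrow> norm (x n - l)"
      using LIMSEQ_ignore_initial_segment[OF l, of n] by (intro tendsto_intros) (simp add: add.commute)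
    show "\<forall>\<^sub>F k in sequentially. norm (x n - x (n + k)) \<le> K / (1 - \<rho>) * \<rho> ^ n"
      using norm_diff_le_geometric[OF K \<rho>] step by (intro always_eventually allI) blast
  qed simp
  with l show thesis by (rule that)
qed

section \<open>Visiting all sets within one window\<close>

lemma cyclic_projections_mem:
  assumes "cyclic_sequence m (\<lambda>i. proj_set (C i)) x"
  shows "x (Suc n) \<in> C (n mod m + 1)"
  using assms proj_setD(1) unfolding cyclic_sequence_def by blast

lemma residue_in_window:
  fixes j m n :: nat
  assumes "j < m"
  obtains k where "k < m" "(n + k) mod m = j"
proof
  \<comment> \<open>Adding \<open>m\<close> before subtracting avoids truncation in the natural
    numbers.\<close>
  show "(j + m - n mod m) mod m < m"
    using assms by simp
  have "(n + (j + m - n mod m) mod m) mod m = (n mod m + (j + m - n mod m)) mod m"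
    by (simp add: mod_simps)
  also have "\<dots> = j"
    using assms by (simp add: less_imp_le trans_le_add2)
  finally show "(n + (j + m - n mod m) mod m) mod m = j" .
qed

text \<open>For \<open>1 \<le> n\<close> the point \<open>x n\<close> is itself the result of a
  projection, so \<open>x n, ..., x (n + (m - 1))\<close> already meet all \<open>m\<close> sets,
  and \<open>m - 1\<close> steps suffice to reach any of them.\<close>

lemma cyclic_projections_infdist_le_path:
  assumes cyc: "cyclic_sequence m (\<lambda>i. proj_set (C i)) x" and n: "1 \<le> n" and i: "i \<in> {1..m}"
  shows "infdist (x n) (C i) \<le> (\<Sum>k<m - 1. norm (x (n + k) - x (Suc (n + k))))"
proof -
  have "i - 1 < m" using i by auto
  \<comment> \<open>The shift by 1 on both sides matches the indexing: \<open>x (Suc j)\<close> lies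
    in \<open>C (j mod m + 1)\<close>.\<close>
  then obtain k where k: "k < m" "(n - 1 + k) mod m = i - 1"
    by (rule residue_in_window)
  then have "x (n + k) \<in> C i"
    using cyclic_projections_mem[OF cyc, of "n - 1 + k"] n i by simp
  then have "infdist (x n) (C i) \<le> norm (x n - x (n + k))"
    by (metis dist_norm infdist_le)
  also have "\<dots> \<le> (\<Sum>j<k. norm (x (n + j) - x (Suc (n + j))))"
    by (rule norm_diff_le_sum_steps)
  also have "\<dots> \<le> (\<Sum>j<m - 1. norm (x (n + j) - x (Suc (n + j))))"
    using k(1) by (intro sum_mono2) auto
  finally show ?thesis .
qed

lemma Max_infdist_le_iff:
  fixes C :: "nat \<Rightarrow> 'a::euclidean_space set"
  assumes "1 \<le> m"
  shows "(MAX i\<in>{1..m}. infdist y (C i)) \<le> b \<longleftrightarrow> (\<forall>i\<in>{1..m}. infdist y (C i) \<le> b)"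
  using assms by simp

text \<open>Nonemptiness matters because \<open>infdist y {}\<close> is 0 by convention.\<close>

lemma infdist_le_infdist_INT:
  assumes "i \<in> I" "(\<Inter>i\<in>I. C i) \<noteq> {}"
  shows "infdist y (C i) \<le> infdist y (\<Inter>i\<in>I. C i)"
  using assms by (intro infdist_mono) auto

section \<open>Decrease of the distance to the intersection\<close>

lemma cyclic_projections_infdist_decrease:
  fixes C :: "nat \<Rightarrow> 'a::euclidean_space set"
  assumes m: "2 \<le> m" and cl: "\<And>i. i \<in> {1..m} \<Longrightarrow> closed (C i)"
    and w: "w \<in> (\<Inter>i\<in>{1..m}. C i)" and \<epsilon>: "0 \<le> \<epsilon>" "\<epsilon> < 1" and \<kappa>: "0 < \<kappa>"
    and linreg: "linearly_regular_on \<kappa> {1..m} C (cball w (\<delta> / 2))"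
    and reg: "regular_system_at \<epsilon> \<delta> {1..m} C w"
    and cyc: "cyclic_sequence m (\<lambda>i. proj_set (C i)) x" and n: "1 \<le> n"
    and near: "\<And>k. k < m - 1 \<Longrightarrow> x (n + k) \<in> cball w (\<delta> / 2)"
  shows "(infdist (x (n + (m - 1))) (\<Inter>i\<in>{1..m}. C i))\<^sup>2
    \<le> (1 / (1 - \<epsilon>) ^ (m - 1) - 1 / (real (m - 1) * \<kappa>\<^sup>2))
        * (infdist (x n) (\<Inter>i\<in>{1..m}. C i))\<^sup>2"
proof -
  let ?D = "\<Inter>i\<in>{1..m}. C i"
  define a where "a k = norm (x (n + k) - x (Suc (n + k)))" for k
  have "closed ?D" "?D \<noteq> {}"
    using cl w by auto
  then obtain c where c: "c \<in> ?D" "infdist (x n) ?D = dist (x n) c"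
    by (metis infdist_attains_inf)
  have xn: "norm (x n - w) \<le> \<delta> / 2"
    using near[of 0] m by (simp add: dist_norm norm_minus_commute)
  have "norm (x n - c) \<le> norm (x n - w)"
    using c infdist_le[OF w, of "x n"] by (simp add: dist_norm)
  then have "dist w c \<le> \<delta>"
    using xn dist_triangle[of w c "x n"] by (simp add: dist_norm norm_minus_commute)
  then have cball: "c \<in> cball w \<delta>" by simp
  have "(norm (x (n + Suc k) - c))\<^sup>2
      \<le> 1 / (1 - \<epsilon>) * (norm (x (n + k) - c))\<^sup>2 - (a k)\<^sup>2" if "k < m - 1" for k
  proof -
    define i where "i = (n + k) mod m + 1"
    have i: "i \<in> {1..m}"
      using m by (simp add: i_def Suc_leI)
    have p: "x (Suc (n + k)) \<in> proj_set (C i) (x (n + k))"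
      using cyc by (simp add: cyclic_sequence_def i_def)
    have "w \<in> C i" "c \<in> C i"
      using i w c(1) by auto
    \<comment> \<open>A projection at most doubles the distance to \<open>w\<close>. Hence radius
      \<open>\<delta> / 2\<close> before each step suffices for regularity at radius
      \<open>\<delta>\<close>, and \<open>near\<close> need not cover the last iterate.\<close>
    moreover have "norm (x (Suc (n + k)) - w) \<le> \<delta>"
      using proj_set_norm_diff_le[OF p \<open>w \<in> C i\<close>] near[OF that]
      by (simp add: dist_norm norm_minus_commute)
    moreover have "regular_set_at \<epsilon> \<delta> (C i) w"
      using reg i by (simp add: regular_system_at_def)
    ultimately show ?thesis
      using regular_proj_step[OF _ \<epsilon> p] cball
      by (simp add: a_def dist_norm norm_minus_commute)
  qed
  then have "(norm (x (n + (m - 1)) - c))\<^sup>2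
      \<le> (1 / (1 - \<epsilon>)) ^ (m - 1) * (norm (x (n + 0) - c))\<^sup>2 - (\<Sum>k<m - 1. (a k)\<^sup>2)"
    using \<epsilon> by (intro telescoped_decrease) auto
  moreover have "(infdist (x (n + (m - 1))) ?D)\<^sup>2 \<le> (norm (x (n + (m - 1)) - c))\<^sup>2"
    using infdist_le[OF c(1)] by (intro power_mono) (auto simp: dist_norm infdist_nonneg)
  moreover have "(infdist (x n) ?D)\<^sup>2 / (real (m - 1) * \<kappa>\<^sup>2) \<le> (\<Sum>k<m - 1. (a k)\<^sup>2)"
  proof -
    have "(MAX i\<in>{1..m}. infdist (x n) (C i)) \<le> (\<Sum>k<m - 1. a k)"
      using cyclic_projections_infdist_le_path[OF cyc n] m
      by (subst Max_infdist_le_iff) (auto simp: a_def)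
    then have "\<kappa> * (MAX i\<in>{1..m}. infdist (x n) (C i)) \<le> \<kappa> * (\<Sum>k<m - 1. a k)"
      using \<kappa> by (intro mult_left_mono) auto
    moreover have "infdist (x n) ?D \<le> \<kappa> * (MAX i\<in>{1..m}. infdist (x n) (C i))"
      using linreg near[of 0] m by (simp add: linearly_regular_on_def)
    ultimately have "infdist (x n) ?D \<le> \<kappa> * (\<Sum>k<m - 1. a k)"
      by (rule order_trans[rotated])
    then have "(infdist (x n) ?D)\<^sup>2 \<le> (\<kappa> * (\<Sum>k<m - 1. a k))\<^sup>2"
      using infdist_nonneg by (rule power_mono)
    also have "\<dots> = \<kappa>\<^sup>2 * (\<Sum>k<m - 1. a k)\<^sup>2"
      by (simp add: power_mult_distrib)
    \<comment> \<open>Cauchy-Schwarz against the constant 1 produces the factor \<open>m - 1\<close>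
      in the rate.\<close>
    also have "(\<Sum>k<m - 1. a k)\<^sup>2 \<le> (\<Sum>k<m - 1. (a k)\<^sup>2) * (\<Sum>k<m - 1. 1\<^sup>2)"
      using Cauchy_Schwarz_ineq_sum[of a "\<lambda>_. 1" "{..<m - 1}"] by simp
    finally have "(infdist (x n) ?D)\<^sup>2 \<le> \<kappa>\<^sup>2 * ((\<Sum>k<m - 1. (a k)\<^sup>2) * real (m - 1))"
      by (simp add: mult_left_mono)
    then show ?thesis
      using \<kappa> m by (simp add: divide_le_eq mult_ac)
  qed
  ultimately show ?thesis
    using c(2) by (simp add: dist_norm power_one_over left_diff_distrib)
qed

lemma cyclic_projections_step_le:
  fixes C :: "nat \<Rightarrow> 'a::euclidean_space set"
  assumes m: "1 \<le> m" and cyc: "cyclic_sequence m (\<lambda>i. proj_set (C i)) x"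
    and w: "w \<in> (\<Inter>i\<in>{1..m}. C i)"
  shows "norm (x n - x (Suc n)) \<le> infdist (x n) (\<Inter>i\<in>{1..m}. C i)"
    and "norm (x (Suc n) - w) \<le> 2 * norm (x n - w)"
proof -
  define i where "i = n mod m + 1"
  have i: "i \<in> {1..m}"
    using m by (simp add: i_def Suc_leI)
  have p: "x (Suc n) \<in> proj_set (C i) (x n)"
    using cyc by (simp add: cyclic_sequence_def i_def)
  show "norm (x n - x (Suc n)) \<le> infdist (x n) (\<Inter>i\<in>{1..m}. C i)"
    using proj_setD(2)[OF p] infdist_le_infdist_INT[OF i, of C "x n"] w by auto
  show "norm (x (Suc n) - w) \<le> 2 * norm (x n - w)"
    using proj_set_norm_diff_le[OF p] w i by blast
qed

text \<open>Each step is bounded by the distance to the intersection, which vanishes once the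
  intersection is reached.\<close>

lemma cyclic_projections_constant:
  fixes C :: "nat \<Rightarrow> 'a::euclidean_space set"
  assumes m: "1 \<le> m" and cyc: "cyclic_sequence m (\<lambda>i. proj_set (C i)) x"
    and N: "x N \<in> (\<Inter>i\<in>{1..m}. C i)"
  shows "x (N + k) = x N"
proof (induction k)
  case (Suc k)
  then show ?case
    using cyclic_projections_step_le(1)[OF m cyc N, of "N + k"] N by simp
qed simp

text \<open>A crude growth bound for the first \<open>m\<close> iterates, where the decrease over a
  window is not yet available.\<close>

lemma cyclic_projections_doubling:
  fixes C :: "nat \<Rightarrow> 'a::euclidean_space set"
  assumes m: "1 \<le> m" and cyc: "cyclic_sequence m (\<lambda>i. proj_set (C i)) x"
    and w: "w \<in> (\<Inter>i\<in>{1..m}. C i)"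
  shows "norm (x n - w) \<le> 2 ^ n * norm (x 0 - w)"
proof (induction n)
  case (Suc n)
  then show ?case
    using cyclic_projections_step_le(2)[OF m cyc w, of n] by simp
qed simp

text \<open>Two facts feed each other in a strong induction: decay of the earlier distances keeps
  the iterates within \<open>\<delta> / 2\<close> of \<open>w\<close>, and this nearness permits the
  next decrease. Assumption \<open>K\<close> starts the induction, while \<open>small\<close> bounds
  the initial distance plus the total path length.\<close>

lemma cyclic_projections_geometric:
  fixes C :: "nat \<Rightarrow> 'a::euclidean_space set"
  assumes m: "2 \<le> m" and cl: "\<And>i. i \<in> {1..m} \<Longrightarrow> closed (C i)"
    and w: "w \<in> (\<Inter>i\<in>{1..m}. C i)" and \<epsilon>: "0 \<le> \<epsilon>" "\<epsilon> < 1" and \<kappa>: "0 < \<kappa>"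
    and linreg: "linearly_regular_on \<kappa> {1..m} C (cball w (\<delta> / 2))"
    and reg: "regular_system_at \<epsilon> \<delta> {1..m} C w"
    and cyc: "cyclic_sequence m (\<lambda>i. proj_set (C i)) x"
    and \<rho>: "0 < \<rho>" "\<rho> < 1"
    and rate: "1 / (1 - \<epsilon>) ^ (m - 1) - 1 / (real (m - 1) * \<kappa>\<^sup>2) \<le> \<rho> ^ (2 * (m - 1))"
    and K: "2 ^ m * norm (x 0 - w) \<le> K * \<rho> ^ m"
    and small: "norm (x 0 - w) + K / (1 - \<rho>) \<le> \<delta> / 2"
  shows "infdist (x n) (\<Inter>i\<in>{1..m}. C i) \<le> K * \<rho> ^ n"
proof -
  let ?d = "\<lambda>n. infdist (x n) (\<Inter>i\<in>{1..m}. C i)"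
  have m1: "1 \<le> m" using m by simp
  have K0: "0 \<le> K"
    using order_trans[OF _ K, of 0] zero_less_power[OF \<rho>(1), of m]
    by (simp add: zero_le_mult_iff)
  have near: "x n \<in> cball w (\<delta> / 2)" if before: "\<And>k. k < n \<Longrightarrow> ?d k \<le> K * \<rho> ^ k" for n
  proof -
    have "norm (x i - x (Suc i)) \<le> K * \<rho> ^ i" if i: "i < n" for i
      by (rule order_trans[OF cyclic_projections_step_le(1)[OF m1 cyc w] before[OF i]])
    then have "norm (x 0 - x n) \<le> K / (1 - \<rho>)"
      using norm_diff_le_geometric[OF K0, of \<rho> n x 0] \<rho> by simp
    moreover have "norm (x n - w) \<le> norm (x 0 - w) + norm (x 0 - x n)"
      using norm_triangle_ineq4[of "x 0 - w" "x 0 - x n"] by simp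
    ultimately have "norm (x n - w) \<le> \<delta> / 2"
      using small by linarith
    then show ?thesis
      by (simp add: dist_norm norm_minus_commute)
  qed
  show ?thesis
  proof (induction n rule: less_induct)
    case (less n)
    show ?case
    proof (cases "n < m")
      case True
      have "?d n \<le> norm (x n - w)"
        using infdist_le[OF w, of "x n"] by (simp add: dist_norm)
      also have "\<dots> \<le> 2 ^ n * norm (x 0 - w)"
        by (rule cyclic_projections_doubling[OF m1 cyc w])
      also have "\<dots> \<le> 2 ^ m * norm (x 0 - w)"
        using True by (intro mult_right_mono power_increasing) auto
      also have "\<dots> \<le> K * \<rho> ^ m" by (rule K)
      \<comment> \<open>As \<open>\<rho> < 1\<close>, the single bound with exponent
        \<open>m\<close> covers all earlier indices.\<close>
      also have "\<dots> \<le> K * \<rho> ^ n"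
        using True \<rho> K0 by (intro mult_left_mono power_decreasing) auto
      finally show ?thesis .
    next
      case False
      \<comment> \<open>From \<open>m \<le> n\<close> follows \<open>1 \<le> n'\<close>. The initial
        segment must include index \<open>m - 1\<close>, since going back from there would reach
        \<open>x 0\<close>, which need not lie in any of the sets.\<close>
      define n' where "n' = n - (m - 1)"
      have n': "n = n' + (m - 1)" "1 \<le> n'" "n' < n"
        using False m by (auto simp: n'_def)
      have "(?d n)\<^sup>2 \<le> (1 / (1 - \<epsilon>) ^ (m - 1) - 1 / (real (m - 1) * \<kappa>\<^sup>2)) * (?d n')\<^sup>2"
        unfolding n'(1)
        using less n' near
        by (intro cyclic_projections_infdist_decrease[OF m cl w \<epsilon> \<kappa> linreg reg cyc]) auto
      also have "\<dots> \<le> \<rho> ^ (2 * (m - 1)) * (?d n')\<^sup>2"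
        using rate by (intro mult_right_mono) auto
      also have "\<dots> = (\<rho> ^ (m - 1) * ?d n')\<^sup>2"
        by (simp add: power_mult_distrib power_mult mult.commute flip: power_mult)
      finally have "?d n \<le> \<rho> ^ (m - 1) * ?d n'"
        using \<rho> by (intro power2_le_imp_le[of "?d n"]) (auto simp: infdist_nonneg)
      also have "\<dots> \<le> \<rho> ^ (m - 1) * (K * \<rho> ^ n')"
        using less n' \<rho> by (intro mult_left_mono) auto
      also have "\<dots> = K * \<rho> ^ n"
        by (simp add: n'(1) power_add)
      finally show ?thesis .
    qed
  qed
qed

text \<open>Every \<open>C i\<close> contains the intersection \<open>D\<close>, so linear
  regularity gives \<open>d \<le> \<kappa> * d\<close> for the distance \<open>d\<close> from
  \<open>y\<close> to \<open>D\<close>. With \<open>\<kappa> < 1\<close> this forces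
  \<open>d = 0\<close>.\<close>

lemma linearly_regular_lt_1_mem:
  fixes C :: "nat \<Rightarrow> 'a::euclidean_space set"
  assumes m: "1 \<le> m" and cl: "\<And>i. i \<in> {1..m} \<Longrightarrow> closed (C i)"
    and w: "w \<in> (\<Inter>i\<in>{1..m}. C i)" and \<kappa>: "0 < \<kappa>" "\<kappa> < 1"
    and linreg: "linearly_regular_on \<kappa> {1..m} C U" and y: "y \<in> U"
  shows "y \<in> (\<Inter>i\<in>{1..m}. C i)"
proof -
  let ?D = "\<Inter>i\<in>{1..m}. C i"
  have ne: "?D \<noteq> {}" and cD: "closed ?D"
    using w cl by auto
  have "(MAX i\<in>{1..m}. infdist y (C i)) \<le> infdist y ?D"
    using infdist_le_infdist_INT[OF _ ne] by (subst Max_infdist_le_iff[OF m]) blast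
  then have "\<kappa> * (MAX i\<in>{1..m}. infdist y (C i)) \<le> \<kappa> * infdist y ?D"
    using \<kappa> by (intro mult_left_mono) auto
  moreover have "infdist y ?D \<le> \<kappa> * (MAX i\<in>{1..m}. infdist y (C i))"
    using linreg y by (simp add: linearly_regular_on_def)
  ultimately have "(1 - \<kappa>) * infdist y ?D \<le> 0"
    by (simp add: algebra_simps)
  then have "infdist y ?D = 0"
    using \<kappa> infdist_nonneg[of y ?D] by (simp add: mult_le_0_iff)
  then show ?thesis
    using in_closed_iff_infdist_zero[OF cD ne] by simp
qed

section \<open>Local R-linear convergence, by the sign of the bracket in the rate\<close>

theorem corollary5p10:
  fixes C :: "nat \<Rightarrow> 'a::euclidean_space set"
    and w :: 'a and m :: nat and \<epsilon> \<delta> \<kappa> \<rho> :: real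
  assumes "2 \<le> m"
    and "\<And>i. i \<in> {1..m} \<Longrightarrow> closed (C i)"
    and "w \<in> (\<Inter>i\<in>{1..m}. C i)"
    and "0 \<le> \<epsilon>" and "\<epsilon> < 1" and "0 < \<delta>"
    and "0 < \<kappa>" and "linearly_regular_on \<kappa> {1..m} C (cball w (\<delta> / 2))"
    and "regular_system_at \<epsilon> \<delta> {1..m} C w"
    and "\<rho> = (max 0 (1 / (1 - \<epsilon>) ^ (m - 1) - 1 / (real (m - 1) * \<kappa>\<^sup>2)))
               powr (1 / (2 * real (m - 1)))"
    and "\<rho> < 1"
  shows "\<exists>r>0. \<forall>x. x 0 \<in> cball w r \<and> cyclic_sequence m (\<lambda>i. proj_set (C i)) x \<longrightarrow>
           (\<exists>xbar \<in> (\<Inter>i\<in>{1..m}. C i).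
              if m = 2 \<and> \<epsilon> = 0 \<and> \<kappa> = 1
              then converges_R_linearly (\<lambda>n. x (Suc n)) xbar \<rho>
              else converges_R_linearly x xbar \<rho>)"
proof -
  let ?D = "\<Inter>i\<in>{1..m}. C i"
  let ?q = "1 / (1 - \<epsilon>) ^ (m - 1) - 1 / (real (m - 1) * \<kappa>\<^sup>2)"
  note m = assms(1) and cl = assms(2) and w = assms(3) and \<epsilon> = assms(4,5) and \<delta> = assms(6)
    and \<kappa> = assms(7) and linreg = assms(8) and reg = assms(9) and \<rho>_def = assms(10)
  have m1: "1 \<le> m" and M: "0 < real (m - 1)"
    using m by auto
  have ne: "?D \<noteq> {}" and cD: "closed ?D"
    using w cl by auto
  show ?thesis
  proof (cases "0 < ?q")
    case True
    have \<rho>: "0 < \<rho>" "\<rho> < 1"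
      using True assms(11) by (auto simp: \<rho>_def)
    have "\<rho> ^ (2 * (m - 1)) = \<rho> powr (2 * real (m - 1))"
      using \<rho>(1) powr_realpow[of \<rho> "2 * (m - 1)"] by simp
    also have "\<dots> = ?q"
      unfolding \<rho>_def using True M by (simp add: powr_powr)
    finally have rate: "?q = \<rho> ^ (2 * (m - 1))" ..
    \<comment> \<open>In the corner case \<open>?q\<close> is exactly 0.\<close>
    have not_corner: "\<not> (m = 2 \<and> \<epsilon> = 0 \<and> \<kappa> = 1)"
      using True by auto
    \<comment> \<open>With \<open>K = A * r\<close>, the constant \<open>A\<close> gives
      \<open>K * \<rho> ^ m = 2 ^ m * r\<close>, and \<open>r\<close> is then the solution of
      \<open>r + K / (1 - \<rho>) = \<delta> / 2\<close>. These are the two smallness conditions for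
      the geometric decay.\<close>
    define A where "A = 2 ^ m / \<rho> ^ m"
    define r where "r = \<delta> / 2 / (1 + A / (1 - \<rho>))"
    have A: "0 < A" using \<rho> by (simp add: A_def)
    have r: "0 < r" "r + A * r / (1 - \<rho>) = \<delta> / 2"
    proof -
      have pos: "0 < 1 + A / (1 - \<rho>)"
        using A \<rho> by (simp add: add_pos_pos)
      then show "0 < r" using \<delta> by (simp add: r_def)
      have "r + A * r / (1 - \<rho>) = r * (1 + A / (1 - \<rho>))"
        by (simp add: algebra_simps)
      also have "\<dots> = \<delta> / 2"
        unfolding r_def using pos by (intro nonzero_eq_divide_eq[THEN iffD1]) auto
      finally show "r + A * r / (1 - \<rho>) = \<delta> / 2" .
    qed
    show ?thesis
    proof (intro exI[of _ r] conjI allI impI r(1), elim conjE)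
      fix x :: "nat \<Rightarrow> 'a"
      assume "x 0 \<in> cball w r" and cyc: "cyclic_sequence m (\<lambda>i. proj_set (C i)) x"
      then have x0: "norm (x 0 - w) \<le> r"
        by (simp add: dist_norm norm_minus_commute)
      have Ar: "0 \<le> A * r" using A r(1) by simp
      have "2 ^ m * norm (x 0 - w) \<le> A * r * \<rho> ^ m"
        using x0 \<rho> by (simp add: A_def)
      moreover have "norm (x 0 - w) + A * r / (1 - \<rho>) \<le> \<delta> / 2"
        using x0 r(2) by simp
      ultimately have d: "infdist (x n) ?D \<le> A * r * \<rho> ^ n" for n
        using cyclic_projections_geometric[OF m cl w \<epsilon> \<kappa> linreg reg cyc \<rho>] rate by simp
      have "norm (x n - x (Suc n)) \<le> A * r * \<rho> ^ n" for n
        using cyclic_projections_step_le(1)[OF m1 cyc w] d by (rule order_trans)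
      then obtain l where l: "x \<longlonglongrightarrow> l"
        and bound: "\<And>n. norm (x n - l) \<le> A * r / (1 - \<rho>) * \<rho> ^ n"
        using geometric_steps_limit[OF Ar, of \<rho> x] \<rho> by auto
      have "(\<lambda>n. A * r * \<rho> ^ n) \<longlonglongrightarrow> A * r * 0"
        using \<rho> by (intro tendsto_intros LIMSEQ_realpow_zero) auto
      then have "infdist l ?D \<le> A * r * 0"
        using d tendsto_infdist[OF l] by (blast intro: LIMSEQ_le)
      then have "l \<in> ?D"
        using in_closed_iff_infdist_zero[OF cD ne] infdist_nonneg[of l ?D] by simp
      moreover have "converges_R_linearly x l \<rho>"
        unfolding converges_R_linearly_def using \<rho> bound Ar
        by (intro conjI exI[of _ "A * r / (1 - \<rho>)"]) auto
      ultimately show "\<exists>xbar\<in>?D. if m = 2 \<and> \<epsilon> = 0 \<and> \<kappa> = 1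
          then converges_R_linearly (\<lambda>n. x (Suc n)) xbar \<rho> else converges_R_linearly x xbar \<rho>"
        using not_corner by auto
    qed
  next
    case False
    \<comment> \<open>The bracket is clipped to 0, and \<open>0 powr a\<close> is 0.\<close>
    then have \<rho>: "\<rho> = 0"
      by (simp add: \<rho>_def)
    show ?thesis
    proof (cases "m = 2 \<and> \<epsilon> = 0 \<and> \<kappa> = 1")
      case corner: True
      show ?thesis
      \<comment> \<open>Radius \<open>\<delta> / 4\<close> allows the first projection to double the
        distance to \<open>w\<close>. The decrease from index 1 has factor 0 and length
        \<open>m - 1 = 1\<close>, so \<open>x 2\<close> is already in the intersection.\<close>
      proof (intro exI[of _ "\<delta> / 4"] conjI allI impI, goal_cases)
        case 1
        show ?case using \<delta> by simp
      next
        case (2 x)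
        then have x0: "norm (x 0 - w) \<le> \<delta> / 4" and cyc: "cyclic_sequence m (\<lambda>i. proj_set (C i)) x"
          by (auto simp: dist_norm norm_minus_commute)
        have "x 1 \<in> cball w (\<delta> / 2)"
          using cyclic_projections_step_le(2)[OF m1 cyc w, of 0] x0
          by (simp add: dist_norm norm_minus_commute)
        then have "(infdist (x 2) ?D)\<^sup>2 \<le> 0"
          using cyclic_projections_infdist_decrease[OF m cl w \<epsilon> \<kappa> linreg reg cyc, of 1] corner
          by (simp add: numeral_2_eq_2)
        then have x2: "x 2 \<in> ?D"
          using in_closed_iff_infdist_zero[OF cD ne] by simp
        \<comment> \<open>Since \<open>0 ^ 0 = 1\<close>, the constant absorbs the error of
          \<open>x 1\<close>; from \<open>x 2\<close> on the sequence is constant.\<close>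
        have "norm (x (Suc n) - x 2) \<le> norm (x 1 - x 2) * 0 ^ n" for n
        proof (cases n)
          case (Suc k)
          then show ?thesis
            using cyclic_projections_constant[OF m1 cyc x2, of k] by simp
        qed simp
        then have "converges_R_linearly (\<lambda>n. x (Suc n)) (x 2) \<rho>"
          unfolding converges_R_linearly_def \<rho> by (auto intro: exI[of _ "norm (x 1 - x 2)"])
        then show ?case
          using corner x2 by auto
      qed
    next
      case not_corner: False
      have "real (m - 1) * \<kappa>\<^sup>2 \<le> (1 - \<epsilon>) ^ (m - 1)"
        using False \<epsilon> \<kappa> M by (simp add: field_simps)
      moreover have "(1 - \<epsilon>) ^ (m - 1) \<le> (1 - \<epsilon>) ^ 1"
        using \<epsilon> m by (intro power_decreasing) auto
      ultimately have le: "real (m - 1) * \<kappa>\<^sup>2 \<le> 1 - \<epsilon>" by simp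
      \<comment> \<open>If \<open>1 \<le> \<kappa>\<close>, then \<open>le\<close> squeezes
        \<open>m - 1\<close> below \<open>1 - \<epsilon>\<close>, which forces \<open>m = 2\<close>,
        \<open>\<epsilon> = 0\<close> and then \<open>\<kappa> = 1\<close>, the excluded
        corner.\<close>
      have "\<kappa> < 1"
      proof (rule ccontr)
        assume "\<not> \<kappa> < 1"
        then have "1 \<le> \<kappa>\<^sup>2" by simp
        then have "real (m - 1) * 1 \<le> real (m - 1) * \<kappa>\<^sup>2"
          by (intro mult_left_mono) auto
        then have "real (m - 1) \<le> 1 - \<epsilon>"
          using le by linarith
        then have "m = 2" "\<epsilon> = 0"
          using \<epsilon> m by auto
        moreover from this have "\<kappa>\<^sup>2 \<le> 1\<^sup>2" using le by simp
        then have "\<kappa> \<le> 1" by (rule power2_le_imp_le) simp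
        ultimately show False
          using not_corner \<open>\<not> \<kappa> < 1\<close> by simp
      qed
      show ?thesis
      \<comment> \<open>The whole ball of linear regularity lies in the intersection, so the
        sequence never moves and its limit is \<open>x 0\<close>.\<close>
      proof (intro exI[of _ "\<delta> / 2"] conjI allI impI, goal_cases)
        case 1
        show ?case using \<delta> by simp
      next
        case (2 x)
        then have x0: "x 0 \<in> ?D" and cyc: "cyclic_sequence m (\<lambda>i. proj_set (C i)) x"
          using linearly_regular_lt_1_mem[OF m1 cl w \<kappa> \<open>\<kappa> < 1\<close> linreg] by auto
        have "converges_R_linearly x (x 0) \<rho>"
          unfolding converges_R_linearly_def \<rho>
          using cyclic_projections_constant[OF m1 cyc x0] by auto
        then show ?case
          using not_corner x0 by auto
      qed
    qed
  qed
qed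

end
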